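(* Let $k\ge 1$ be an integer. For every graph $G$ with tree-width at most $k$, we have $\gamma(G)\le k\cdot\rho(G)$.
   Context: All graphs are finite and simple. For a vertex $v$ of a graph $G$, $N_G[v]$ denotes the closed neighborhood of $v$. A dominating set of $G$ is a set of vertices whose closed neighborhoods together cover $V(G)$; $\gamma(G)$ denotes the minimum size of a dominating set. A packing in $G$ is a set of vertices whose closed neighborhoods are pairwise disjoint (equivalently, pairwise at distance at least $3$); $\rho(G)$ denotes the maximum size of a packing. The tree-width of $G$ is $\min\{\omega(H)-1 \mid G \text{ is a subgraph of } H \text{ and } H \text{ is chordal}\}$, where $\omega(H)$ is the order of the largest clique of $H$. *)

theory Defs
  imports "Graph_Theory.Graph_Theory" "HOL-Library.Disjoint_Sets"
begin

text \<open>
  A finite simple graph is a \<^locale>\<open>pair_graph\<close>: a finite, loop-free, symmetric digraph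
  without parallel arcs, in which an edge uv is the pair of arcs (u,v), (v,u).
\<close>

definition closed_neighborhood :: "'a pair_pre_digraph \<Rightarrow> 'a \<Rightarrow> 'a set" where
  "closed_neighborhood G v = insert v {u. (v, u) \<in> parcs G}"

definition dominating_set :: "'a pair_pre_digraph \<Rightarrow> 'a set \<Rightarrow> bool" where
  "dominating_set G D \<longleftrightarrow>
     D \<subseteq> pverts G \<and> (\<Union>v\<in>D. closed_neighborhood G v) = pverts G"

definition domination_number :: "'a pair_pre_digraph \<Rightarrow> nat" where
  "domination_number G = Min (card ` {D. dominating_set G D})"

definition packing :: "'a pair_pre_digraph \<Rightarrow> 'a set \<Rightarrow> bool" where
  "packing G P \<longleftrightarrow> P \<subseteq> pverts G \<and> disjoint_family_on (closed_neighborhood G) P"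

definition packing_number :: "'a pair_pre_digraph \<Rightarrow> nat" where
  "packing_number G = Max (card ` {P. packing G P})"

definition clique :: "'a pair_pre_digraph \<Rightarrow> 'a set \<Rightarrow> bool" where
  "clique G C \<longleftrightarrow> C \<subseteq> pverts G \<and> pairwise (\<lambda>u v. (u, v) \<in> parcs G) C"

definition clique_number :: "'a pair_pre_digraph \<Rightarrow> nat" where
  "clique_number G = Max (card ` {C. clique G C})"

text \<open>
  A cycle is given by its list of arcs, so \<^term>\<open>fst ` set p\<close> is its vertex set. The
  length bound also excludes the closed walks u, v, u, which
  \<^const>\<open>pre_digraph.cycle\<close> admits in symmetric digraphs.
\<close>

definition chordal :: "'a pair_pre_digraph \<Rightarrow> bool" where
  "chordal G \<longleftrightarrow>
     (\<forall>p. pre_digraph.cycle (with_proj G) p \<and> length p \<ge> 4 \<longrightarrow>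
       (\<exists>u\<in>fst ` set p. \<exists>v\<in>fst ` set p.
          (u, v) \<in> parcs G \<and> (u, v) \<notin> set p \<and> (v, u) \<notin> set p))"

text \<open>
  The supergraphs H use the vertex type of G. This loses nothing: for an arbitrary chordal
  supergraph, the subgraph induced on the vertices of G is chordal, contains G and has no larger
  cliques. The set is nonempty (it contains the value for the complete graph on the vertices
  of G) and bounded below by -1, so the infimum is a minimum. It is taken in the integers
  because the graph without vertices has tree-width -1.
\<close>

definition tree_width :: "'a pair_pre_digraph \<Rightarrow> int" where
  "tree_width G =
     Inf {int (clique_number H) - 1 | H.
            pair_graph H \<and> subgraph (with_proj G) (with_proj H) \<and> chordal H}"

end

theory Submission
  imports Defs
begin

text \<open>
  The proof is a greedy argument that dominates a given set \<open>S\<close> of vertices while it builds a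
  packing inside \<open>S\<close>. Let \<open>H\<close> be a chordal supergraph of \<open>G\<close> with clique number at most \<open>k + 1\<close>.
  One round picks a vertex \<open>s \<in> S\<close> and a set \<open>D\<close> of at most \<open>k\<close> vertices that dominates every
  \<open>u \<in> S\<close> at distance at most 2 from \<open>s\<close> in \<open>G\<close>, including \<open>s\<close>; then \<open>s\<close> joins the packing and the
  dominated vertices leave \<open>S\<close>. The vertices which remain are at distance at least 3 from \<open>s\<close>, so the
  vertices picked form a packing. Starting with all vertices of \<open>G\<close> gives the bound
  (\<open>chordal_greedy\<close>).

  To choose \<open>s\<close>, delete simplicial vertices of \<open>H\<close> that lie outside \<open>S\<close> until, in the set \<open>W\<close> of
  remaining vertices, some vertex of \<open>S\<close> is simplicial; this is \<open>s\<close>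
  (\<open>chordal_obtain_simplicial_in\<close>). Let \<open>A\<close> be the set of neighbours of \<open>s\<close> in \<open>W\<close> with respect to
  \<open>H\<close>, so that \<open>A\<close> together with \<open>s\<close> is a clique and \<open>A\<close> has at most \<open>k\<close> elements. The neighbours in
  \<open>W\<close> of a deleted vertex form a clique of \<open>H\<close>. Hence a vertex \<open>u \<in> S\<close>, \<open>u \<noteq> s\<close>, which has a common
  neighbour with \<open>s\<close> outside \<open>W\<close> is itself in \<open>A\<close>, and so every \<open>u \<in> S\<close> within distance 2 of \<open>s\<close>
  other than \<open>s\<close> is in \<open>A\<close> or is adjacent to a vertex in \<open>A\<close> that is adjacent to \<open>s\<close>. If \<open>s\<close> has a
  neighbour in \<open>A\<close> with respect to \<open>G\<close>, then the vertices of \<open>G\<close> in \<open>A\<close> form the desired set.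
  Otherwise only \<open>s\<close> and vertices \<open>u \<in> A\<close> have to be dominated; if there is such a \<open>u\<close>, replace one
  of them in \<open>A\<close> by its common neighbour with \<open>s\<close>, and if there is none, take \<open>s\<close> alone
  (\<open>chordal_greedy_step\<close>).

  The simplicial vertices are supplied by Dirac's theorem on chordal graphs, in the form that
  if a vertex \<open>v\<close> is not adjacent to all other vertices, then some simplicial vertex is different
  from \<open>v\<close> and not adjacent to \<open>v\<close> (\<open>chordal_simplicial_vertices\<close>).
\<close>


section \<open>Simplicial vertices of chordal graphs\<close>

text \<open>The neighbours of \<open>s\<close> that lie in \<open>W\<close>; the vertex \<open>s\<close> itself need not lie in \<open>W\<close>.\<close>

definition nbrs :: "'a pair_pre_digraph \<Rightarrow> 'a set \<Rightarrow> 'a \<Rightarrow> 'a set" where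
  "nbrs H W s = {u \<in> W. (s, u) \<in> parcs H}"

text \<open>\<open>s\<close> is a simplicial vertex of the subgraph induced by \<open>W\<close>: its neighbours form a clique.\<close>

definition simplicial :: "'a pair_pre_digraph \<Rightarrow> 'a set \<Rightarrow> 'a \<Rightarrow> bool" where
  "simplicial H W s \<longleftrightarrow> s \<in> W \<and> clique H (nbrs H W s)"

lemma clique_subset: "clique G C \<Longrightarrow> B \<subseteq> C \<Longrightarrow> clique G B"
  unfolding clique_def by (auto intro: pairwise_subset)

lemma cliqueD: "clique G C \<Longrightarrow> u \<in> C \<Longrightarrow> v \<in> C \<Longrightarrow> u \<noteq> v \<Longrightarrow> (u, v) \<in> parcs G"
  unfolding clique_def pairwise_def by blast

lemma pair_graph_sym: "pair_graph G \<Longrightarrow> (u, v) \<in> parcs G \<Longrightarrow> (v, u) \<in> parcs G"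
  by (simp add: pair_graph_def pair_pseudo_graph_def pair_sym_digraph.arcs_symmetric)

lemma pair_graph_no_loop: "pair_graph G \<Longrightarrow> (u, u) \<notin> parcs G"
  by (metis pair_graph_def pair_digraph_def pair_loopfree_digraph.no_loops')

lemma pair_graph_in_verts:
  assumes "pair_graph G" "(u, v) \<in> parcs G"
  shows "u \<in> pverts G" "v \<in> pverts G"
proof -
  interpret pair_graph G by fact
  show "u \<in> pverts G" "v \<in> pverts G"
    using assms(2) by (auto dest: in_arcsD1 in_arcsD2)
qed

lemma pair_graph_finite_verts: "pair_graph G \<Longrightarrow> finite (pverts G)"
  by (metis pair_graph_def pair_digraph_def pair_fin_digraph.pair_finite_verts)

lemma pcas_path_append:
  "pcas (f 0) (map (\<lambda>i. (f i, f (Suc i))) [0..<n] @ q) b = pcas (f n) q b"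
  by (induction n arbitrary: q) auto

text \<open>
  A shortest path in \<open>U\<close> from \<open>x\<close> to \<open>y\<close> is induced. If \<open>x\<close> and \<open>y\<close> were not adjacent, it would
  form a chordless cycle of length at least 4 with \<open>v\<close>.
\<close>

lemma chordal_attachments_adjacent:
  assumes H: "pair_graph H" "chordal H"
    and v: "v \<notin> U" "(v, x) \<in> parcs H" "(v, y) \<in> parcs H"
    and others: "\<And>z. z \<in> U \<Longrightarrow> (v, z) \<in> parcs H \<Longrightarrow> z = x \<or> z = y"
    and xy: "x \<in> U" "x \<noteq> y"
    and conn: "(x, y) \<in> (parcs H \<inter> U \<times> U)\<^sup>*"
  shows "(x, y) \<in> parcs H"
proof (rule ccontr)
  assume nonadj: "(x, y) \<notin> parcs H"
  interpret pair_graph H by (fact H(1))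
  define R where "R = parcs H \<inter> U \<times> U"
  define n where "n = (LEAST n. (x, y) \<in> R ^^ n)"
  have ex: "\<exists>n. (x, y) \<in> R ^^ n"
    using conn unfolding R_def by (auto simp: rtrancl_power)
  have xy_n: "(x, y) \<in> R ^^ n"
    unfolding n_def by (rule LeastI_ex) (rule ex)
  have n_le: "n \<le> m" if "(x, y) \<in> R ^^ m" for m
    unfolding n_def by (rule Least_le) (rule that)
  obtain f where f: "f 0 = x" "f n = y" "\<And>i. i < n \<Longrightarrow> (f i, f (Suc i)) \<in> R"
    using xy_n unfolding relpow_fun_conv by blast
  have inU: "f i \<in> U" if "i \<le> n" for i
  proof (cases i)
    case 0
    then show ?thesis using f(1) xy(1) by simp
  next
    case (Suc j)
    then show ?thesis using f(3)[of j] that unfolding R_def by auto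
  qed
  have start: "(x, f i) \<in> R ^^ i" if "i \<le> n" for i
    unfolding relpow_fun_conv using f(1,3) that by (intro exI[of _ f]) auto
  have rest: "(f i, y) \<in> R ^^ (n - i)" if "i \<le> n" for i
    unfolding relpow_fun_conv using f(2,3) that
    by (intro exI[of _ "\<lambda>j. f (i + j)"]) auto
  have neq: "f i \<noteq> f j" if "i < j" "j \<le> n" for i j
  proof
    assume "f i = f j"
    then have "(x, y) \<in> R ^^ (i + (n - j))"
      using relpow_trans[OF start[of i], of y "n - j"] rest[of j] that by simp
    from n_le[OF this] show False using that by linarith
  qed
  have induced: "j = Suc i" if "i < j" "j \<le> n" "(f i, f j) \<in> parcs H" for i j
  proof -
    have "(f i, f j) \<in> R" using that inU unfolding R_def by auto
    then have "(x, f j) \<in> R ^^ Suc i" using start[of i] that by auto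
    then have "(x, y) \<in> R ^^ (Suc i + (n - j))"
      using relpow_trans[of x "f j" "Suc i" R y "n - j"] rest[of j] that by blast
    from n_le[OF this] show ?thesis using that by linarith
  qed
  have n0: "n \<noteq> 0" using f(1,2) xy(2) by (metis)
  have n1: "n \<noteq> 1"
  proof
    assume "n = 1"
    then show False using f(1,2) f(3)[of 0] nonadj unfolding R_def by auto
  qed
  have n2: "n \<ge> 2" using n0 n1 by linarith
  define p where "p = (v, f 0) # map (\<lambda>i. (f i, f (Suc i))) [0..<n] @ [(f n, v)]"
  have arcs_p: "set p \<subseteq> parcs H"
    using v f pair_graph_sym[OF H(1)] unfolding p_def R_def by auto
  have verts_p: "pawalk_verts v p = v # map f [0..<Suc n] @ [v]"
    using awalk_verts_conv[of v p] unfolding p_def by (auto simp: comp_def)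
  have "pcas v p v" unfolding p_def by (simp add: pcas_path_append del: cas_append_iff)
  then have "awalk v p v"
    unfolding awalk_def using arcs_p pair_graph_in_verts[OF H(1) v(2)] by blast
  moreover have "distinct (map f [0..<Suc n] @ [v])"
  proof -
    have "inj_on f {0..<Suc n}"
      by (rule linorder_inj_onI) (use neq in auto)
    then show ?thesis using inU v(1) by (auto simp: distinct_map simp del: upt_Suc)
  qed
  ultimately have "cycle p"
    unfolding cycle_def using verts_p by (intro exI[of _ v]) (auto simp: p_def)
  moreover have "length p \<ge> 4" using n2 by (simp add: p_def)
  ultimately obtain a b where ab: "a \<in> fst ` set p" "b \<in> fst ` set p"
    "(a, b) \<in> parcs H" "(a, b) \<notin> set p" "(b, a) \<notin> set p"
    using H(2) unfolding chordal_def by blast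
  have fst_p: "fst ` set p = insert v (f ` {..n})"
  proof -
    have "fst ` set p = insert v (f ` insert n {..<n})"
      by (simp add: p_def image_image lessThan_atLeast0 insert_commute)
    moreover have "insert n {..<n} = {..n}" by auto
    ultimately show ?thesis by simp
  qed
  have at_v: "(v, z) \<in> set p \<or> (z, v) \<in> set p" if "z \<in> U" "(v, z) \<in> parcs H" for z
    using others[OF that] f(1,2) unfolding p_def by auto
  have on_path: "(f i, f j) \<in> set p" if "i < j" "j \<le> n" "(f i, f j) \<in> parcs H" for i j
    using induced[OF that] that(2) unfolding p_def by auto
  have ba: "(b, a) \<in> parcs H" using ab(3) pair_graph_sym[OF H(1)] by blast
  consider "a = v" "b = v" | i where "a = v" "b = f i" "i \<le> n"
    | i where "b = v" "a = f i" "i \<le> n"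
    | i j where "a = f i" "b = f j" "i \<le> n" "j \<le> n"
    using ab(1,2) unfolding fst_p by auto
  then show False
  proof cases
    case 1
    then show ?thesis using ab(3) pair_graph_no_loop[OF H(1)] by auto
  next
    case (2 i)
    then show ?thesis using at_v[of b] ab inU by auto
  next
    case (3 i)
    then show ?thesis using at_v[of a] ab ba inU by auto
  next
    case (4 i j)
    then show ?thesis
      using on_path[of i j] on_path[of j i] ab ba pair_graph_no_loop[OF H(1)]
      by (metis linorder_neqE_nat)
  qed
qed

text \<open>
  Dirac's theorem for induced subgraphs. For a vertex \<open>w\<close> not adjacent to \<open>v\<close>, let \<open>C\<close> be the
  component of \<open>w\<close> after removal of the closed neighbourhood of \<open>v\<close>, and \<open>S\<close> the set of vertices
  outside \<open>C\<close> with a neighbour in \<open>C\<close>. The set \<open>S\<close> is a clique, and a vertex of \<open>C\<close> has no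
  neighbours outside \<open>C \<union> S\<close>; so it suffices to find a vertex of \<open>C\<close> which is simplicial in
  \<open>C \<union> S\<close>. If some \<open>s \<in> S\<close> is not adjacent to all of \<open>C \<union> S\<close>, the induction hypothesis for
  \<open>C \<union> S\<close> gives a simplicial vertex not adjacent to \<open>s\<close>, which is not in the clique \<open>S\<close>. Otherwise
  any simplicial vertex of \<open>C\<close> will do.
\<close>

lemma chordal_simplicial_vertices:
  assumes H: "pair_graph H" "chordal H" and "W \<subseteq> pverts H"
  shows "(W \<noteq> {} \<longrightarrow> (\<exists>s. simplicial H W s)) \<and>
    (\<forall>v\<in>W. \<forall>w\<in>W. w \<noteq> v \<and> (v, w) \<notin> parcs H \<longrightarrow>
      (\<exists>s. simplicial H W s \<and> s \<noteq> v \<and> (v, s) \<notin> parcs H))"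
  using \<open>W \<subseteq> pverts H\<close>
proof (induction "card W" arbitrary: W rule: less_induct)
  case less
  note sym = pair_graph_sym[OF H(1)]
  have fin: "finite W"
    using less.prems pair_graph_finite_verts[OF H(1)] finite_subset by blast
  have nonadj: "\<exists>s. simplicial H W s \<and> s \<noteq> v \<and> (v, s) \<notin> parcs H"
    if v: "v \<in> W" and w: "w \<in> W" "w \<noteq> v" "(v, w) \<notin> parcs H" for v w
  proof -
    define X where "X = {z \<in> W. z \<noteq> v \<and> (v, z) \<notin> parcs H}"
    define C where "C = {z. (w, z) \<in> (parcs H \<inter> X \<times> X)\<^sup>*}"
    define S where "S = {s \<in> W. (v, s) \<in> parcs H \<and> (\<exists>c\<in>C. (s, c) \<in> parcs H)}"
    have wX: "w \<in> X" using w by (auto simp: X_def)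
    have wC: "w \<in> C" by (auto simp: C_def)
    have CX: "C \<subseteq> X"
    proof
      fix z assume "z \<in> C"
      then have "(w, z) \<in> (parcs H \<inter> X \<times> X)\<^sup>*" by (simp add: C_def)
      then show "z \<in> X" using wX by (cases rule: rtrancl.cases) auto
    qed
    have C_closed: "z \<in> C" if "c \<in> C" "z \<in> X" "(c, z) \<in> parcs H" for c z
      using that CX unfolding C_def by (auto intro: rtrancl.rtrancl_into_rtrancl)
    have nbr_C: "z \<in> C \<union> S" if "c \<in> C" "z \<in> W" "(c, z) \<in> parcs H" for c z
    proof (cases "z \<in> X")
      case True
      then show ?thesis using C_closed that by blast
    next
      case False
      moreover have "z \<noteq> v" using that CX sym by (auto simp: X_def)
      ultimately show ?thesis using that sym by (auto simp: X_def S_def)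
    qed
    have reach: "(w, z) \<in> (parcs H \<inter> C \<times> C)\<^sup>*" if "z \<in> C" for z
    proof -
      have "(w, z) \<in> (parcs H \<inter> X \<times> X)\<^sup>*" using that by (simp add: C_def)
      then show ?thesis
      proof (induction rule: rtrancl_induct)
        case (step y z)
        then have "y \<in> C" "z \<in> C"
          by (auto simp: C_def intro: rtrancl.rtrancl_into_rtrancl)
        then have "(y, z) \<in> parcs H \<inter> C \<times> C" using step.hyps by auto
        with step.IH show ?case by (rule rtrancl.rtrancl_into_rtrancl)
      qed simp
    qed
    have S_clique: "clique H S"
      unfolding clique_def
    proof (intro conjI pairwiseI)
      show "S \<subseteq> pverts H" using less.prems by (auto simp: S_def)
    next
      fix x y assume xy: "x \<in> S" "y \<in> S" "x \<noteq> y"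
      obtain c d where cd: "c \<in> C" "(x, c) \<in> parcs H" "d \<in> C" "(y, d) \<in> parcs H"
        using xy by (auto simp: S_def)
      define U where "U = insert x (insert y C)"
      have "sym (parcs H \<inter> C \<times> C)" using sym by (auto simp: sym_def)
      then have "(c, w) \<in> (parcs H \<inter> C \<times> C)\<^sup>*"
        using reach[OF cd(1)] by (meson sym_rtrancl symD)
      then have "(c, d) \<in> (parcs H \<inter> C \<times> C)\<^sup>*"
        using reach[OF cd(3)] by (rule rtrancl_trans)
      then have "(c, d) \<in> (parcs H \<inter> U \<times> U)\<^sup>*"
        by (rule rtrancl_mono[THEN subsetD, rotated]) (auto simp: U_def)
      moreover have "(x, c) \<in> parcs H \<inter> U \<times> U" "(d, y) \<in> parcs H \<inter> U \<times> U"
        using cd sym by (auto simp: U_def)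
      ultimately have conn: "(x, y) \<in> (parcs H \<inter> U \<times> U)\<^sup>*"
        by (meson converse_rtrancl_into_rtrancl rtrancl.rtrancl_into_rtrancl)
      show "(x, y) \<in> parcs H"
      proof (rule chordal_attachments_adjacent[OF H _ _ _ _ _ _ conn])
        show "v \<notin> U"
          using xy CX pair_graph_no_loop[OF H(1)] by (auto simp: U_def S_def X_def)
        show "z = x \<or> z = y" if "z \<in> U" "(v, z) \<in> parcs H" for z
          using that CX by (auto simp: U_def X_def)
      qed (use xy in \<open>auto simp: S_def U_def\<close>)
    qed
    have sub: "C \<union> S \<subseteq> W - {v}"
      using CX pair_graph_no_loop[OF H(1)] by (auto simp: X_def S_def)
    have smaller: "card B < card W" if "B \<subseteq> C \<union> S" for B
      using sub that v fin by (intro psubset_card_mono) auto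
    have "\<exists>c\<in>C. clique H (nbrs H (C \<union> S) c)"
    proof (cases "\<exists>s\<in>S. \<exists>t\<in>C \<union> S. t \<noteq> s \<and> (s, t) \<notin> parcs H")
      case True
      then obtain s t where st: "s \<in> S" "t \<in> C \<union> S" "t \<noteq> s" "(s, t) \<notin> parcs H" by blast
      moreover have "C \<union> S \<subseteq> pverts H" using sub less.prems by blast
      ultimately obtain c where c: "simplicial H (C \<union> S) c" "c \<noteq> s" "(s, c) \<notin> parcs H"
        using less.hyps[of "C \<union> S"] smaller[of "C \<union> S"] by blast
      have "c \<notin> S" using cliqueD[OF S_clique st(1)] c(2,3) by blast
      then show ?thesis using c(1) by (auto simp: simplicial_def)
    next
      case False
      have "C \<subseteq> pverts H" using sub less.prems by blast
      then obtain c where c: "simplicial H C c"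
        using less.hyps[of C] smaller[of C] wC by blast
      have "clique H (nbrs H (C \<union> S) c)"
        unfolding clique_def
      proof (intro conjI pairwiseI)
        show "nbrs H (C \<union> S) c \<subseteq> pverts H" using sub less.prems by (auto simp: nbrs_def)
      next
        fix a b assume ab: "a \<in> nbrs H (C \<union> S) c" "b \<in> nbrs H (C \<union> S) c" "a \<noteq> b"
        consider "a \<in> S" | "b \<in> S" | "a \<in> nbrs H C c" "b \<in> nbrs H C c"
          using ab by (auto simp: nbrs_def)
        then show "(a, b) \<in> parcs H"
        proof cases
          case 1
          then show ?thesis using False ab by (auto simp: nbrs_def)
        next
          case 2
          then have "(b, a) \<in> parcs H" using False ab by (auto simp: nbrs_def)
          then show ?thesis by (rule sym)
        next
          case 3
          then show ?thesis using c ab(3) cliqueD by (auto simp: simplicial_def)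
        qed
      qed
      then show ?thesis using c by (auto simp: simplicial_def)
    qed
    then obtain c where c: "c \<in> C" "clique H (nbrs H (C \<union> S) c)" by blast
    have "nbrs H W c \<subseteq> nbrs H (C \<union> S) c"
      using nbr_C[OF c(1)] by (auto simp: nbrs_def)
    then have "simplicial H W c"
      using c CX clique_subset by (auto simp: simplicial_def X_def)
    then show ?thesis using c(1) CX by (auto simp: X_def)
  qed
  have "\<exists>s. simplicial H W s" if ne: "W \<noteq> {}"
  proof (cases "\<exists>v\<in>W. \<exists>w\<in>W. w \<noteq> v \<and> (v, w) \<notin> parcs H")
    case True
    then show ?thesis using nonadj by blast
  next
    case False
    then have "clique H (nbrs H W s)" for s
      using less.prems by (auto simp: clique_def pairwise_def nbrs_def)
    then show ?thesis using ne by (auto simp: simplicial_def)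
  qed
  with nonadj show ?case by blast
qed

text \<open>
  The set \<open>W\<close> is what remains when simplicial vertices outside \<open>S\<close> are removed one after another
  until a vertex of \<open>S\<close> is simplicial. The last conclusion is what survives of a removed vertex \<open>x\<close>
  having been simplicial at its removal.
\<close>

lemma chordal_obtain_simplicial_in:
  assumes H: "pair_graph H" "chordal H" and S: "S \<subseteq> pverts H" "S \<noteq> {}"
  obtains W s where "S \<subseteq> W" "W \<subseteq> pverts H" "s \<in> S" "simplicial H W s"
    "\<And>x. x \<in> pverts H - W \<Longrightarrow> clique H (nbrs H W x)"
proof -
  define good where "good W \<longleftrightarrow> S \<subseteq> W \<and> W \<subseteq> pverts H \<and>
    (\<forall>x\<in>pverts H - W. clique H (nbrs H W x))" for W
  have "good (pverts H)" using S by (auto simp: good_def)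
  then obtain W where W: "good W" and least: "\<And>W'. card W' < card W \<Longrightarrow> \<not> good W'"
    using exists_least_iff[of "\<lambda>n. \<exists>W. good W \<and> card W = n"] by metis
  have "W \<noteq> {}" using W S by (auto simp: good_def)
  then obtain s where s: "simplicial H W s"
    using chordal_simplicial_vertices[OF H, of W] W by (auto simp: good_def)
  have "s \<in> S"
  proof (rule ccontr)
    assume "s \<notin> S"
    have "clique H (nbrs H (W - {s}) x)" if "x \<in> pverts H - (W - {s})" for x
    proof (rule clique_subset)
      show "clique H (nbrs H W x)"
        using that W s by (cases "x = s") (auto simp: good_def simplicial_def)
    qed (auto simp: nbrs_def)
    then have "good (W - {s})" using W \<open>s \<notin> S\<close> by (auto simp: good_def)
    moreover have "finite W"
      using W pair_graph_finite_verts[OF H(1)] finite_subset by (auto simp: good_def)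
    then have "card (W - {s}) < card W"
      using s by (intro card_Diff1_less) (auto simp: simplicial_def)
    ultimately show False using least by blast
  qed
  then show thesis using W s by (intro that[of W s]) (auto simp: good_def)
qed


section \<open>Greedy domination\<close>

lemma card_clique_le:
  assumes "finite (pverts H)" "clique H C"
  shows "card C \<le> clique_number H"
  unfolding clique_number_def
proof (rule Max_ge)
  have "{C. clique H C} \<subseteq> Pow (pverts H)" by (auto simp: clique_def)
  then show "finite (card ` {C. clique H C})"
    using assms(1) by (metis finite_Pow_iff finite_imageI finite_subset)
qed (use assms(2) in auto)

lemma in_closed_neighborhood_sym:
  "pair_graph G \<Longrightarrow> u \<in> closed_neighborhood G v \<longleftrightarrow> v \<in> closed_neighborhood G u"
  unfolding closed_neighborhood_def using pair_graph_sym by fastforce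

text \<open>
  The vertices of \<open>H\<close> may form a proper superset of those of \<open>G\<close>, so the set \<open>A\<close> of neighbours of \<open>s\<close>
  in \<open>H\<close> has to be intersected with the vertices of \<open>G\<close>.
\<close>

lemma chordal_greedy_step:
  assumes G: "pair_graph G" and H: "pair_graph H" "chordal H"
    and sub: "pverts G \<subseteq> pverts H" "parcs G \<subseteq> parcs H"
    and k: "clique_number H \<le> k + 1" "k \<ge> 1"
    and S: "S \<subseteq> pverts G" "S \<noteq> {}"
  obtains s D where "s \<in> S" "D \<subseteq> pverts G" "card D \<le> k"
    "\<And>u. u \<in> S \<Longrightarrow> closed_neighborhood G u \<inter> closed_neighborhood G s \<noteq> {} \<Longrightarrow>
      u \<in> (\<Union>d\<in>D. closed_neighborhood G d)"
proof -
  note symG = pair_graph_sym[OF G] and symH = pair_graph_sym[OF H(1)]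
  have "S \<subseteq> pverts H" using S sub by blast
  then obtain W s where W: "S \<subseteq> W" "W \<subseteq> pverts H" "s \<in> S" "simplicial H W s"
    and removed: "\<And>x. x \<in> pverts H - W \<Longrightarrow> clique H (nbrs H W x)"
    using chordal_obtain_simplicial_in[OF H _ S(2)] by blast
  define A where "A = nbrs H W s"
  have fin: "finite A"
    using finite_subset[OF W(2) pair_graph_finite_verts[OF H(1)]]
    by (simp add: A_def nbrs_def)
  have "clique H (insert s A)"
    unfolding clique_def pairwise_insert
  proof (intro conjI ballI impI)
    have "clique H A" using W(4) by (simp add: simplicial_def A_def)
    then show "pairwise (\<lambda>u v. (u, v) \<in> parcs H) A" by (simp add: clique_def)
    show "insert s A \<subseteq> pverts H" using W(1-3) by (auto simp: A_def nbrs_def)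
  qed (use symH in \<open>auto simp: A_def nbrs_def\<close>)
  then have "card (insert s A) \<le> k + 1"
    using card_clique_le[OF pair_graph_finite_verts[OF H(1)]] k(1) by (meson order_trans)
  moreover have "s \<notin> A" using pair_graph_no_loop[OF H(1)] by (auto simp: A_def nbrs_def)
  ultimately have cardA: "card A \<le> k" using fin by simp
  have near: "u \<in> A \<or> (\<exists>y\<in>A. (s, y) \<in> parcs G \<and> (y, u) \<in> parcs G)"
    if u: "u \<in> S" "u \<noteq> s"
      and x: "x \<in> closed_neighborhood G u" "x \<in> closed_neighborhood G s" for u x
  proof (cases "x = u \<or> x = s")
    case True
    then have "(s, u) \<in> parcs G"
      using u x symG by (auto simp: closed_neighborhood_def)
    then show ?thesis using u W sub by (auto simp: A_def nbrs_def)
  next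
    case False
    then have adj: "(u, x) \<in> parcs G" "(s, x) \<in> parcs G"
      using x by (auto simp: closed_neighborhood_def)
    show ?thesis
    proof (cases "x \<in> W")
      case True
      then have "x \<in> A" using adj sub by (auto simp: A_def nbrs_def)
      then show ?thesis using adj symG by blast
    next
      case False
      moreover have "x \<in> pverts H" using adj pair_graph_in_verts[OF G] sub by blast
      ultimately have "clique H (nbrs H W x)" using removed by blast
      moreover have "u \<in> nbrs H W x" "s \<in> nbrs H W x"
        using u W adj sub symG by (auto simp: nbrs_def)
      ultimately have "(s, u) \<in> parcs H" using cliqueD u(2) by metis
      then show ?thesis using u W by (auto simp: A_def nbrs_def)
    qed
  qed
  show thesis
  proof (cases "\<exists>y\<in>A. (s, y) \<in> parcs G")
    case True
    then obtain y where y: "y \<in> A" "(s, y) \<in> parcs G" by blast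
    show thesis
    proof (rule that[of s "A \<inter> pverts G"])
      show "card (A \<inter> pverts G) \<le> k"
        using cardA fin card_mono[of A "A \<inter> pverts G"] by auto
      fix u assume u: "u \<in> S" "closed_neighborhood G u \<inter> closed_neighborhood G s \<noteq> {}"
      show "u \<in> (\<Union>d\<in>A \<inter> pverts G. closed_neighborhood G d)"
      proof (cases "u = s")
        case True
        then have "y \<in> A \<inter> pverts G" "u \<in> closed_neighborhood G y"
          using y symG[OF y(2)] pair_graph_in_verts[OF G y(2)]
          by (auto simp: closed_neighborhood_def)
        then show ?thesis by blast
      next
        case False
        then have "u \<in> A \<or> (\<exists>y\<in>A. (s, y) \<in> parcs G \<and> (y, u) \<in> parcs G)"
          using u near by blast
        then show ?thesis using u(1) S pair_graph_in_verts[OF G]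
          by (auto simp: closed_neighborhood_def)
      qed
    qed (use W in auto)
  next
    case False
    then have nearA: "u \<in> A" if "u \<in> S" "u \<noteq> s"
      "closed_neighborhood G u \<inter> closed_neighborhood G s \<noteq> {}" for u
      using near that by blast
    show thesis
    proof (cases "\<exists>u\<in>S. u \<noteq> s \<and> closed_neighborhood G u \<inter> closed_neighborhood G s \<noteq> {}")
      case True
      then obtain u0 x where u0: "u0 \<in> S" "u0 \<noteq> s"
        and x: "x \<in> closed_neighborhood G u0" "x \<in> closed_neighborhood G s" by blast
      have u0A: "u0 \<in> A" using nearA[of u0] u0 x by blast
      have xG: "x \<in> pverts G"
        using x(1) u0(1) S pair_graph_in_verts[OF G] by (auto simp: closed_neighborhood_def)
      show thesis
      proof (rule that[of s "insert x ((A - {u0}) \<inter> pverts G)"])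
        have "card ((A - {u0}) \<inter> pverts G) \<le> card (A - {u0})"
          using fin by (intro card_mono) auto
        also have "\<dots> < card A" using fin u0A by (rule card_Diff1_less)
        finally show "card (insert x ((A - {u0}) \<inter> pverts G)) \<le> k"
          using cardA card_insert_le_m1[of k "(A - {u0}) \<inter> pverts G" x] k(2) by linarith
        fix u assume u: "u \<in> S" "closed_neighborhood G u \<inter> closed_neighborhood G s \<noteq> {}"
        show "u \<in> (\<Union>d\<in>insert x ((A - {u0}) \<inter> pverts G). closed_neighborhood G d)"
        proof (cases "u = s \<or> u = u0")
          case True
          then show ?thesis using x in_closed_neighborhood_sym[OF G] by auto
        next
          case False
          then have "u \<in> (A - {u0}) \<inter> pverts G" using nearA u S by blast
          then show ?thesis by (auto simp: closed_neighborhood_def)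
        qed
      qed (use W xG in auto)
    next
      case False
      show thesis
        by (rule that[of s "{s}"])
          (use W(3) S k(2) False in \<open>auto simp: closed_neighborhood_def\<close>)
    qed
  qed
qed

lemma chordal_greedy:
  assumes G: "pair_graph G" and H: "pair_graph H" "chordal H"
    and sub: "pverts G \<subseteq> pverts H" "parcs G \<subseteq> parcs H"
    and k: "clique_number H \<le> k + 1" "k \<ge> 1"
    and "S \<subseteq> pverts G"
  shows "\<exists>D P. D \<subseteq> pverts G \<and> S \<subseteq> (\<Union>d\<in>D. closed_neighborhood G d) \<and>
    P \<subseteq> S \<and> disjoint_family_on (closed_neighborhood G) P \<and> card D \<le> k * card P"
  using \<open>S \<subseteq> pverts G\<close>
proof (induction "card S" arbitrary: S rule: less_induct)
  case less
  have fin: "finite S"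
    using less.prems pair_graph_finite_verts[OF G] finite_subset by blast
  show ?case
  proof (cases "S = {}")
    case True
    then show ?thesis
      by (intro exI[of _ "{}"]) (auto simp: disjoint_family_on_def)
  next
    case False
    obtain s D where s: "s \<in> S" and D: "D \<subseteq> pverts G" "card D \<le> k"
      and dom: "\<And>u. u \<in> S \<Longrightarrow> closed_neighborhood G u \<inter> closed_neighborhood G s \<noteq> {} \<Longrightarrow>
        u \<in> (\<Union>d\<in>D. closed_neighborhood G d)"
      using chordal_greedy_step[OF G H sub k less.prems False] by blast
    define T where "T = S - (\<Union>d\<in>D. closed_neighborhood G d)"
    have "s \<notin> T" using dom[OF s] by (auto simp: T_def closed_neighborhood_def)
    then have "T \<subset> S" using s by (auto simp: T_def)
    then have "card T < card S" using fin by (simp add: psubset_card_mono)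
    moreover have "T \<subseteq> pverts G" using \<open>T \<subset> S\<close> less.prems by blast
    ultimately obtain D' P where D': "D' \<subseteq> pverts G" "T \<subseteq> (\<Union>d\<in>D'. closed_neighborhood G d)"
      "card D' \<le> k * card P"
      and P: "P \<subseteq> T" "disjoint_family_on (closed_neighborhood G) P"
      using less.hyps[of T] by blast
    have far: "closed_neighborhood G u \<inter> closed_neighborhood G s = {}" if "u \<in> P" for u
      using that P(1) dom[of u] by (auto simp: T_def)
    have "s \<notin> P" using \<open>s \<notin> T\<close> P(1) by blast
    moreover have "finite P" using P(1) \<open>T \<subset> S\<close> fin by (meson finite_subset psubset_imp_subset)
    ultimately have "card (D \<union> D') \<le> k * card (insert s P)"
      using card_Un_le[of D D'] D(2) D'(3) by simp
    moreover have "disjoint_family_on (closed_neighborhood G) (insert s P)"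
      using P(2) far by (auto simp: disjoint_family_on_def)
    moreover have "S \<subseteq> (\<Union>d\<in>D \<union> D'. closed_neighborhood G d)"
      using D'(2) by (auto simp: T_def)
    moreover have "insert s P \<subseteq> S" using s P(1) \<open>T \<subset> S\<close> by blast
    moreover have "D \<union> D' \<subseteq> pverts G" using D(1) D'(1) by blast
    ultimately show ?thesis by blast
  qed
qed


section \<open>Tree-width\<close>

text \<open>
  A complete supergraph is chordal. Its existence matters since the infimum over an empty set of
  integers carries no information.
\<close>

lemma ex_chordal_supergraph:
  assumes G: "pair_graph G"
  shows "\<exists>H. pair_graph H \<and> subgraph (with_proj G) (with_proj H) \<and> chordal H"
proof -
  define H where "H = \<lparr>pverts = pverts G, parcs = pverts G \<times> pverts G - Id\<rparr>"
  have finG: "finite (pverts G)" by (rule pair_graph_finite_verts[OF G])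
  have H: "pair_graph H"
    by unfold_locales (use finG in \<open>auto simp: H_def symmetric_def sym_def\<close>)
  interpret H: pair_graph H by (fact H)
  interpret G: pair_graph G by (fact G)
  have "subgraph (with_proj G) (with_proj H)"
    unfolding subgraph_def
    using G.wf_digraph H.wf_digraph pair_graph_in_verts[OF G] pair_graph_no_loop[OF G]
    by (auto simp: H_def compatible_def)
  moreover have "chordal H"
    unfolding chordal_def
  proof (intro allI impI)
    fix p assume "pre_digraph.cycle (with_proj H) p \<and> length p \<ge> 4"
    then have "H.cycle p" "length p \<ge> 4" by auto
    then obtain u where u: "H.awalk u p u" "distinct (tl (pawalk_verts u p))"
      unfolding H.cycle_def by auto
    obtain e1 p1 where p1: "p = e1 # p1" "length p1 \<ge> 3"
      using \<open>length p \<ge> 4\<close> by (cases p) auto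
    obtain e2 p2 where p2: "p1 = e2 # p2" "length p2 \<ge> 2"
      using p1 by (cases p1) auto
    obtain e3 p3 where p3: "p2 = e3 # p3" "length p3 \<ge> 1"
      using p2 by (cases p2) auto
    obtain e4 q where q: "p3 = e4 # q"
      using p3 by (cases p3) auto
    have p: "p = e1 # e2 # e3 # e4 # q" using p1 p2 p3 q by simp
    have heads: "distinct (map snd p)"
      using u H.awalk_verts_conv'[of u p u] by (auto simp: H.awalk_def p)
    have same: "e = e'" if "e \<in> set p" "e' \<in> set p" "snd e = snd e'" for e e'
      using heads that by (meson distinct_map inj_onD)
    have walk: "snd e1 = fst e2" "snd e2 = fst e3" "snd e3 = fst e4"
      and arcs: "set p \<subseteq> parcs H"
      using u(1) by (auto simp: H.awalk_def p)
    \<comment> \<open>The tail of \<open>e4\<close> is two steps ahead of that of \<open>e2\<close>; every vertex is the head of only one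
      arc of the cycle. So this chord could lie on the cycle only as \<open>e3\<close>, which starts elsewhere,
      or reversed as \<open>e1\<close>, which would close the cycle after three arcs.\<close>
    have ne: "fst e2 \<noteq> fst e4" using heads walk by (auto simp: p)
    have "(fst e2, fst e4) \<notin> set p"
    proof
      assume "(fst e2, fst e4) \<in> set p"
      moreover have "e3 \<in> set p" by (simp add: p)
      ultimately have "(fst e2, fst e4) = e3"
        using walk same by simp
      then have "fst e2 = fst e3" by (metis fst_conv)
      moreover have "(fst e2, snd e2) \<in> parcs H" using arcs by (simp add: p)
      ultimately show False using walk pair_graph_no_loop[OF H] by metis
    qed
    moreover have "(fst e4, fst e2) \<notin> set p"
    proof
      assume "(fst e4, fst e2) \<in> set p"
      moreover have "e1 \<in> set p" by (simp add: p)
      ultimately have "(fst e4, fst e2) = e1"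
        using walk same by simp
      then have "fst e1 = fst e4" by (metis fst_conv)
      then have "snd (last (e4 # q)) = snd e3"
        using u(1) walk H.awalk_verts_conv[of u p] H.awlast_if_cas[of u p u]
        by (auto simp: H.awalk_def p)
      then have "snd e3 \<in> snd ` set (e4 # q)"
        by (metis image_eqI last_in_set list.distinct(1))
      then show False using heads by (auto simp: p)
    qed
    moreover have "(fst e2, fst e4) \<in> parcs H"
      using ne arcs by (auto simp: p H_def)
    ultimately show "\<exists>u\<in>fst ` set p. \<exists>v\<in>fst ` set p.
        (u, v) \<in> parcs H \<and> (u, v) \<notin> set p \<and> (v, u) \<notin> set p"
      by (intro bexI[of _ "fst e2"] bexI[of _ "fst e4"]) (auto simp: p)
  qed
  ultimately show ?thesis using H by blast
qed

theorem theorem1p9: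
  fixes k :: nat and G :: "'a pair_pre_digraph"
  assumes "k \<ge> 1"
    and "pair_graph G"
    and "tree_width G \<le> int k"
  shows "domination_number G \<le> k * packing_number G"
proof -
  define X where "X = {int (clique_number H) - 1 | H.
    pair_graph H \<and> subgraph (with_proj G) (with_proj H) \<and> chordal H}"
  have "X \<noteq> {}" unfolding X_def using ex_chordal_supergraph[OF assms(2)] by blast
  moreover have "Inf X < int k + 1" using assms(3) by (simp add: tree_width_def X_def)
  ultimately obtain w where "w \<in> X" "w < int k + 1"
    using cInf_lessD by blast
  then obtain H where H: "pair_graph H" "chordal H" "subgraph (with_proj G) (with_proj H)"
    and "int (clique_number H) - 1 < int k + 1"
    unfolding X_def by blast
  then have k: "clique_number H \<le> k + 1" by linarith
  have sub: "pverts G \<subseteq> pverts H" "parcs G \<subseteq> parcs H"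
    using H(3) by (auto simp: subgraph_def)
  obtain D P where D: "D \<subseteq> pverts G" "pverts G \<subseteq> (\<Union>d\<in>D. closed_neighborhood G d)"
    and P: "P \<subseteq> pverts G" "disjoint_family_on (closed_neighborhood G) P"
    and card_le: "card D \<le> k * card P"
    using chordal_greedy[OF assms(2) H(1,2) sub k assms(1) order_refl] by blast
  have fin: "finite (card ` {X. Q X})" if "\<And>X. Q X \<Longrightarrow> X \<subseteq> pverts G" for Q
  proof -
    have "{X. Q X} \<subseteq> Pow (pverts G)" using that by auto
    then show ?thesis
      using pair_graph_finite_verts[OF assms(2)]
      by (metis finite_Pow_iff finite_imageI finite_subset)
  qed
  have "dominating_set G D"
    using D pair_graph_in_verts[OF assms(2)]
    by (auto simp: dominating_set_def closed_neighborhood_def)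
  then have "domination_number G \<le> card D"
    unfolding domination_number_def
    by (intro Min_le fin) (auto simp: dominating_set_def)
  also note card_le
  also have "card P \<le> packing_number G"
    unfolding packing_number_def
    by (intro Max_ge fin) (use P in \<open>auto simp: packing_def\<close>)
  finally show ?thesis by simp
qed

end
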